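(* Let $F$ be a finite abelian group, $r \in \mathbb{N}$, and $G = F \times \mathbb{T}^r$, where $\mathbb{T}$ is the multiplicative group of complex numbers of modulus one. Let $K \subset \widehat{G}$. Then $K$ is strictly positive definite if and only if $K$ is ubiquitous.
   Context: For a compact abelian group $G$ with character group $\widehat{G}$ (here $\widehat{G} \cong \widehat{F} \times \mathbb{Z}^r$, where $m \in \mathbb{Z}^r$ acts on $\mathbb{T}^r$ by $z \mapsto z_1^{m_1}\cdots z_r^{m_r}$): a trigonometric polynomial on $\widehat{G}$ is a function of the form $\gamma \mapsto \sum_{i=1}^n c_i \gamma(x_i)$ with $n \in \mathbb{N}$, $x_1,\dots,x_n \in G$, $c_1,\dots,c_n \in \mathbb{C}$. A subset $K \subset \widehat{G}$ is called strictly positive definite if the only trigonometric polynomial on $\widehat{G}$ vanishing at every point of $K$ is the identically zero function. A subset $K \subset \widehat{G}$ is called ubiquitous if for every subgroup $H$ of $\widehat{G}$ of finite index and every $\gamma \in \widehat{G}$ the coset $\gamma H$ meets $K$. *)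

theory Defs
  imports Complex_Main "HOL-Algebra.Coset"
begin

text \<open>The finite abelian group F is a finite type 'f with additive abelian group structure.
  G = F x T^r; a point of T^r is z :: nat => complex with |z i| = 1 for i < r
  (and normalised z i = 1 for i >= r). The dual group is F^ x Z^r, with
  m :: nat => int supported in {..<r}.\<close>

definition characters :: "('f::ab_group_add \<Rightarrow> complex) set" where
  "characters = {\<chi>. (\<forall>x. norm (\<chi> x) = 1) \<and> (\<forall>x y. \<chi> (x + y) = \<chi> x * \<chi> y)}"

definition torus_pts :: "nat \<Rightarrow> (nat \<Rightarrow> complex) set" where
  "torus_pts r = {z. (\<forall>i<r. norm (z i) = 1) \<and> (\<forall>i\<ge>r. z i = 1)}"

definition G_pts :: "nat \<Rightarrow> ('f::ab_group_add \<times> (nat \<Rightarrow> complex)) set" where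
  "G_pts r = UNIV \<times> torus_pts r"

definition dual_carrier :: "nat \<Rightarrow> (('f::ab_group_add \<Rightarrow> complex) \<times> (nat \<Rightarrow> int)) set" where
  "dual_carrier r = characters \<times> {m. \<forall>i\<ge>r. m i = 0}"

definition dual_group :: "nat \<Rightarrow> (('f::ab_group_add \<Rightarrow> complex) \<times> (nat \<Rightarrow> int)) monoid" where
  "dual_group r = \<lparr> carrier = dual_carrier r,
      mult = (\<lambda>a b. ((\<lambda>x. fst a x * fst b x), (\<lambda>i. snd a i + snd b i))),
      one = ((\<lambda>_. 1), (\<lambda>_. 0)) \<rparr>"

definition char_eval :: "nat \<Rightarrow> (('f::ab_group_add \<Rightarrow> complex) \<times> (nat \<Rightarrow> int))
    \<Rightarrow> ('f \<times> (nat \<Rightarrow> complex)) \<Rightarrow> complex" where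
  "char_eval r \<gamma> x = fst \<gamma> (fst x) * (\<Prod>i<r. (snd x i) powi (snd \<gamma> i))"

definition trig_poly :: "nat \<Rightarrow> nat \<Rightarrow> (nat \<Rightarrow> 'f::ab_group_add \<times> (nat \<Rightarrow> complex))
    \<Rightarrow> (nat \<Rightarrow> complex) \<Rightarrow> ('f \<Rightarrow> complex) \<times> (nat \<Rightarrow> int) \<Rightarrow> complex" where
  "trig_poly r n x c \<gamma> = (\<Sum>i<n. c i * char_eval r \<gamma> (x i))"

definition strictly_pd :: "nat \<Rightarrow> (('f::ab_group_add \<Rightarrow> complex) \<times> (nat \<Rightarrow> int)) set \<Rightarrow> bool" where
  "strictly_pd r K \<longleftrightarrow>
     (\<forall>n x c. (\<forall>i<n. x i \<in> G_pts r) \<and> (\<forall>\<gamma>\<in>K. trig_poly r n x c \<gamma> = 0)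
        \<longrightarrow> (\<forall>\<gamma>\<in>dual_carrier r. trig_poly r n x c \<gamma> = 0))"

definition ubiquitous :: "nat \<Rightarrow> (('f::ab_group_add \<Rightarrow> complex) \<times> (nat \<Rightarrow> int)) set \<Rightarrow> bool" where
  "ubiquitous r K \<longleftrightarrow>
     (\<forall>H \<gamma>. subgroup H (dual_group r) \<and> finite (rcosets\<^bsub>dual_group r\<^esub> H) \<and> \<gamma> \<in> dual_carrier r
        \<longrightarrow> (\<gamma> <#\<^bsub>dual_group r\<^esub> H) \<inter> K \<noteq> {})"

end

theory Submission
  imports Defs "HOL-Algebra.Multiplicative_Group" "HOL-Computational_Algebra.Polynomial"
begin

text \<open>
  A subgroup of finite index contains the subgroup \<open>H\<^sub>N = 1 \<times> (N\<int>)\<^sup>r\<close> for some \<open>N > 0\<close>, so that it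
  suffices to consider the cosets of these. By orthogonality of characters on the finite group of
  points \<open>(f, z)\<close> of \<open>G\<close> with \<open>z\<^sup>N = 1\<close>, the indicator function of \<open>\<gamma>H\<^sub>N\<close> is a trigonometric
  polynomial up to scaling. Hence strictly positive definite sets are ubiquitous.

  Conversely, let a trigonometric polynomial take a value \<open>d \<noteq> 0\<close> at \<open>\<gamma>\<close>. On the elements with the
  same \<open>F\<close>-component as \<open>\<gamma>\<close> it is a finite sum \<open>\<Sum>\<^sub>i c\<^sub>i \<Prod>\<^sub>j z\<^sub>i\<^sub>j\<^bsup>m\<^sub>j\<^esup>\<close>. The ring generated by all \<open>c\<^sub>i\<close>,
  \<open>z\<^sub>i\<^sub>j\<close> and \<open>z\<^sub>i\<^sub>j\<^bsup>-1\<^esup>\<close> has a proper ideal of finite index modulo which \<open>d\<close> is a unit. Modulo that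
  ideal the units \<open>z\<^sub>i\<^sub>j\<close> have finite order, so the polynomial is congruent to \<open>d\<close>, and in particular
  nonzero, on \<open>\<gamma>H\<^sub>N\<close> for some \<open>N\<close>.

  The ideal is found by adjoining generators one at a time, from \<open>A\<close> to \<open>A[x]\<close>. If \<open>x\<close> is
  transcendental over \<open>A\<close>, specialize \<open>x\<close> to an element of \<open>A\<close> where the polynomial expressing \<open>d\<close>
  does not vanish, and pull back an ideal of \<open>A\<close>. If \<open>x\<close> is algebraic, \<open>d\<close> divides some nonzero
  \<open>e \<in> A\<close>; make \<open>e\<close> and the leading coefficient of a minimal polynomial of \<open>x\<close> units modulo an
  ideal \<open>I\<close> of \<open>A\<close>, and extend \<open>I\<close> to \<open>I[x]\<close>.
\<close>

section \<open>Subrings, ideals and polynomials over them\<close>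

locale unital_subring =
  fixes A :: "'a::comm_ring_1 set"
  assumes one_mem: "1 \<in> A"
    and diff_mem: "\<And>a b. a \<in> A \<Longrightarrow> b \<in> A \<Longrightarrow> a - b \<in> A"
    and mult_mem: "\<And>a b. a \<in> A \<Longrightarrow> b \<in> A \<Longrightarrow> a * b \<in> A"
begin

lemma zero_mem: "0 \<in> A"
  using diff_mem[OF one_mem one_mem] by simp

lemma minus_mem: "a \<in> A \<Longrightarrow> - a \<in> A"
  using diff_mem[OF zero_mem] by simp

lemma add_mem: "a \<in> A \<Longrightarrow> b \<in> A \<Longrightarrow> a + b \<in> A"
  using diff_mem[OF _ minus_mem] by simp

lemma power_mem: "a \<in> A \<Longrightarrow> a ^ n \<in> A"
  by (induction n) (auto intro: one_mem mult_mem)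

lemma sum_mem: "(\<And>i. i \<in> S \<Longrightarrow> f i \<in> A) \<Longrightarrow> sum f S \<in> A"
  by (induction S rule: infinite_finite_induct) (auto intro: zero_mem add_mem)

lemma prod_mem: "(\<And>i. i \<in> S \<Longrightarrow> f i \<in> A) \<Longrightarrow> prod f S \<in> A"
  by (induction S rule: infinite_finite_induct) (auto intro: one_mem mult_mem)

end

locale subring_ideal = unital_subring +
  fixes I
  assumes subset: "I \<subseteq> A"
    and zero_ideal: "0 \<in> I"
    and add_ideal: "\<And>a b. a \<in> I \<Longrightarrow> b \<in> I \<Longrightarrow> a + b \<in> I"
    and mult_ideal: "\<And>a b. a \<in> A \<Longrightarrow> b \<in> I \<Longrightarrow> a * b \<in> I"
begin

lemma mult_ideal_right: "a \<in> I \<Longrightarrow> b \<in> A \<Longrightarrow> a * b \<in> I"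
  using mult_ideal[of b a] by (simp add: mult.commute)

lemma minus_ideal: "a \<in> I \<Longrightarrow> - a \<in> I"
  using mult_ideal[OF minus_mem[OF one_mem]] by simp

lemma diff_ideal: "a \<in> I \<Longrightarrow> b \<in> I \<Longrightarrow> a - b \<in> I"
  using add_ideal[OF _ minus_ideal] by simp

lemma sum_ideal: "(\<And>i. i \<in> S \<Longrightarrow> f i \<in> I) \<Longrightarrow> sum f S \<in> I"
  by (induction S rule: infinite_finite_induct) (auto intro: zero_ideal add_ideal)

lemma mult_cong_one:
  assumes "1 - a \<in> I" "1 - b \<in> I" "b \<in> A"
  shows "1 - a * b \<in> I"
proof -
  have "1 - a * b = (1 - a) * b + (1 - b)"
    by (simp add: algebra_simps)
  then show ?thesis
    using assms by (metis add_ideal mult_ideal_right)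
qed

lemma power_cong_one:
  assumes "1 - a \<in> I" "a \<in> A"
  shows "1 - a ^ k \<in> I"
  using assms by (induction k) (auto simp: zero_ideal intro: mult_cong_one power_mem)

lemma prod_cong_one:
  assumes "\<And>j. j \<in> S \<Longrightarrow> a j \<in> A" "\<And>j. j \<in> S \<Longrightarrow> 1 - a j \<in> I"
  shows "1 - prod a S \<in> I"
  using assms
  by (induction S rule: infinite_finite_induct) (auto simp: zero_ideal intro!: mult_cong_one prod_mem)

end

lemma (in unital_subring) subring_ideal_self: "subring_ideal A A"
  by unfold_locales (auto intro: zero_mem add_mem mult_mem)

definition unit_mod :: "'a::comm_ring_1 set \<Rightarrow> 'a set \<Rightarrow> 'a \<Rightarrow> bool" where
  "unit_mod A I a \<longleftrightarrow> (\<exists>u\<in>A. 1 - a * u \<in> I)"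

lemma (in unital_subring) unit_mod_factor:
  assumes "unit_mod A I (a * b)" "b \<in> A"
  shows "unit_mod A I a"
  using assms unfolding unit_mod_def by (metis mult.assoc mult_mem)

definition polys_over :: "'a::zero set \<Rightarrow> 'a poly set" where
  "polys_over A = {q. \<forall>i. coeff q i \<in> A}"

lemma polys_overI: "(\<And>i. coeff q i \<in> A) \<Longrightarrow> q \<in> polys_over A"
  and polys_overD: "q \<in> polys_over A \<Longrightarrow> coeff q i \<in> A"
  by (auto simp: polys_over_def)

lemma pCons_polys_over: "a \<in> A \<Longrightarrow> q \<in> polys_over A \<Longrightarrow> pCons a q \<in> polys_over A"
  by (auto simp: polys_over_def coeff_pCons split: nat.split)

lemma monom_polys_over: "0 \<in> A \<Longrightarrow> a \<in> A \<Longrightarrow> monom a n \<in> polys_over A"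
  by (auto simp: polys_over_def coeff_monom)

lemma polys_over_mono: "A \<subseteq> B \<Longrightarrow> polys_over A \<subseteq> polys_over B"
  by (auto simp: polys_over_def)

lemma (in unital_subring) unital_subring_polys_over: "unital_subring (polys_over A)"
proof
  show "1 \<in> polys_over A"
    using monom_polys_over[OF zero_mem one_mem, of 0] by simp
qed (auto simp: polys_over_def coeff_mult intro!: diff_mem sum_mem mult_mem)

lemma (in subring_ideal) subring_ideal_polys_over: "subring_ideal (polys_over A) (polys_over I)"
proof -
  interpret polys: unital_subring "polys_over A"
    by (rule unital_subring_polys_over)
  show ?thesis
    by unfold_locales
      (use subset in \<open>auto simp: polys_over_def coeff_mult
        intro: zero_ideal add_ideal intro!: sum_ideal mult_ideal\<close>)
qed

definition adjoin :: "'a::comm_semiring_0 set \<Rightarrow> 'a \<Rightarrow> 'a set" where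
  "adjoin A x = (\<lambda>q. poly q x) ` polys_over A"

lemma poly_in_adjoin: "q \<in> polys_over A \<Longrightarrow> poly q x \<in> adjoin A x"
  by (simp add: adjoin_def)

lemma subset_adjoin: "0 \<in> A \<Longrightarrow> A \<subseteq> adjoin A x"
  using poly_in_adjoin[OF monom_polys_over, of A _ 0 x] by (auto simp: monom_0)

lemma (in unital_subring) poly_mem:
  assumes "q \<in> polys_over A" "a \<in> A"
  shows "poly q a \<in> A"
  unfolding poly_altdef using assms by (intro sum_mem mult_mem power_mem polys_overD)

lemma (in unital_subring) adjoin_generator: "x \<in> adjoin A x"
  using poly_in_adjoin[OF monom_polys_over[OF zero_mem one_mem, of 1], of x]
  by (simp add: poly_monom)

lemma (in unital_subring) unital_subring_adjoin: "unital_subring (adjoin A x)"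
proof -
  interpret polys: unital_subring "polys_over A"
    by (rule unital_subring_polys_over)
  show ?thesis
  proof
    show "1 \<in> adjoin A x"
      using poly_in_adjoin[OF polys.one_mem] by simp
  qed (auto simp: adjoin_def simp flip: poly_diff poly_mult
      intro!: imageI polys.diff_mem polys.mult_mem)
qed

lemma (in subring_ideal) subring_ideal_adjoin: "subring_ideal (adjoin A x) (adjoin I x)"
proof -
  interpret polys: subring_ideal "polys_over A" "polys_over I"
    by (rule subring_ideal_polys_over)
  interpret adjoin: unital_subring "adjoin A x"
    by (rule unital_subring_adjoin)
  show ?thesis
  proof
    show "adjoin I x \<subseteq> adjoin A x"
      using polys.subset by (auto simp: adjoin_def)
    show "0 \<in> adjoin I x"
      using poly_in_adjoin[OF polys.zero_ideal] by simp
  qed (auto simp: adjoin_def simp flip: poly_add poly_mult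
      intro!: imageI polys.add_ideal polys.mult_ideal)
qed

lemma (in subring_ideal) pseudo_divmod_main_polys_over:
  assumes "l \<in> A" "d \<in> polys_over A" "q \<in> polys_over I" "r \<in> polys_over I"
  shows "pseudo_divmod_main l q r d dr n \<in> polys_over I \<times> polys_over I"
  using assms
proof (induction n arbitrary: q r dr)
  case (Suc n)
  interpret polys: subring_ideal "polys_over A" "polys_over I"
    by (rule subring_ideal_polys_over)
  define m where "m = monom (coeff r dr) n"
  have "m \<in> polys_over I"
    unfolding m_def using Suc.prems by (intro monom_polys_over zero_ideal polys_overD)
  moreover have "smult l p \<in> polys_over I" if "p \<in> polys_over I" for p
    using that \<open>l \<in> A\<close> by (auto simp: polys_over_def intro: mult_ideal)
  ultimately have "smult l q + m \<in> polys_over I" "smult l r - m * d \<in> polys_over I"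
    using Suc.prems by (auto intro!: polys.add_ideal polys.diff_ideal polys.mult_ideal_right)
  then show ?case
    using Suc.IH Suc.prems(1,2) by (simp add: Let_def m_def)
qed simp

lemma (in subring_ideal) pseudo_division:
  assumes g: "g \<in> polys_over A" "g \<noteq> 0" and q: "q \<in> polys_over I"
  obtains k h s where "h \<in> polys_over I" "s \<in> polys_over I"
    "smult (lead_coeff g ^ k) q = g * h + s" "s = 0 \<or> degree s < degree g"
proof -
  obtain h s where divmod: "pseudo_divmod q g = (h, s)"
    by fastforce
  have "pseudo_divmod q g \<in> polys_over I \<times> polys_over I"
    unfolding pseudo_divmod_def using g q monom_polys_over[OF zero_ideal zero_ideal, of 0]
    by (simp add: pseudo_divmod_main_polys_over polys_overD)
  then show ?thesis
    using that pseudo_divmod[OF g(2) divmod] divmod by auto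
qed

section \<open>Ideals of finite index in finitely generated domains\<close>

locale finite_index_ideal = subring_ideal +
  assumes proper: "1 \<notin> I"
    and finite_index: "\<exists>T. finite T \<and> (\<forall>a\<in>A. \<exists>t\<in>T. a - t \<in> I)"
begin

lemma unit_mod_not_mem:
  assumes "unit_mod A I a"
  shows "a \<notin> I"
proof
  assume "a \<in> I"
  obtain u where "u \<in> A" "1 - a * u \<in> I"
    using assms by (auto simp: unit_mod_def)
  then have "(1 - a * u) + a * u \<in> I"
    using \<open>a \<in> I\<close> by (intro add_ideal mult_ideal_right)
  then show False
    using proper by simp
qed

lemma unit_mod_power:
  assumes "unit_mod A I a" "a \<in> A"
  shows "unit_mod A I (a ^ k)"
proof -
  obtain u where u: "u \<in> A" "1 - a * u \<in> I"
    using assms(1) by (auto simp: unit_mod_def)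
  then have "1 - a ^ k * u ^ k \<in> I"
    using assms(2) by (simp add: power_cong_one mult_mem flip: power_mult_distrib)
  then show ?thesis
    using u power_mem by (auto simp: unit_mod_def)
qed

lemma finite_index_ideal_vimage:
  assumes B: "unital_subring B" and \<phi>: "\<phi> \<in> B \<rightarrow> A" "\<phi> 1 = 1"
    and \<phi>_diff: "\<And>a b. a \<in> B \<Longrightarrow> b \<in> B \<Longrightarrow> \<phi> (a - b) = \<phi> a - \<phi> b"
    and \<phi>_mult: "\<And>a b. a \<in> B \<Longrightarrow> b \<in> B \<Longrightarrow> \<phi> (a * b) = \<phi> a * \<phi> b"
  shows "finite_index_ideal B {b \<in> B. \<phi> b \<in> I}"
proof -
  interpret B: unital_subring B
    by fact
  have \<phi>_zero: "\<phi> 0 = 0"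
    using \<phi>_diff[OF B.one_mem B.one_mem] by simp
  have \<phi>_add: "\<phi> (a + b) = \<phi> a + \<phi> b" if "a \<in> B" "b \<in> B" for a b
    using \<phi>_diff[OF B.add_mem[OF that] that(2)] by simp
  obtain T where T: "finite T" "\<And>a. a \<in> A \<Longrightarrow> \<exists>t\<in>T. a - t \<in> I"
    using finite_index by blast
  define lift where "lift t = (SOME b. b \<in> B \<and> \<phi> b - t \<in> I)" for t
  have "\<exists>b'\<in>lift ` T. b - b' \<in> {b \<in> B. \<phi> b \<in> I}" if b: "b \<in> B" for b
  proof -
    obtain t where t: "t \<in> T" "\<phi> b - t \<in> I"
      using T(2) b \<phi>(1) by blast
    then have lift: "lift t \<in> B" "\<phi> (lift t) - t \<in> I"
      using b someI[of "\<lambda>b. b \<in> B \<and> \<phi> b - t \<in> I" b] by (auto simp: lift_def)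
    have "(\<phi> b - t) - (\<phi> (lift t) - t) \<in> I"
      using t(2) lift(2) by (rule diff_ideal)
    then show ?thesis
      using t(1) b lift(1) by (intro bexI[of _ "lift t"]) (simp_all add: \<phi>_diff B.diff_mem)
  qed
  then have "\<exists>T. finite T \<and> (\<forall>b\<in>B. \<exists>t\<in>T. b - t \<in> {b \<in> B. \<phi> b \<in> I})"
    using T(1) by blast
  then show ?thesis
    by unfold_locales
      (use \<phi> proper in \<open>auto simp: \<phi>_zero \<phi>_add \<phi>_mult zero_ideal B.zero_mem Pi_iff
        intro: add_ideal mult_ideal B.add_mem B.mult_mem\<close>)
qed

end

definition residually_finite_units :: "'a::comm_ring_1 set \<Rightarrow> bool" where
  "residually_finite_units A \<longleftrightarrow>
     (\<forall>a\<in>A. a \<noteq> 0 \<longrightarrow> (\<exists>I. finite_index_ideal A I \<and> unit_mod A I a))"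

lemma residually_finite_unitsE:
  assumes "residually_finite_units A" "a \<in> A" "a \<noteq> 0"
  obtains I where "finite_index_ideal A I" "unit_mod A I a"
  using assms by (auto simp: residually_finite_units_def)

lemma unital_subring_Ints: "unital_subring \<int>"
  by unfold_locales auto

lemma finite_index_ideal_Ints:
  assumes "m \<ge> 2"
  shows "finite_index_ideal (\<int> :: 'a::{comm_ring_1, ring_char_0} set) ((*) (of_int m) ` \<int>)"
proof -
  let ?I = "(*) (of_int m) ` \<int> :: 'a set"
  interpret unital_subring "\<int> :: 'a set"
    by (rule unital_subring_Ints)
  show ?thesis
  proof
    show "?I \<subseteq> \<int>"
      by auto
    show "0 \<in> ?I"
      by (intro image_eqI[of _ _ 0]) auto
    show "a + b \<in> ?I" if "a \<in> ?I" "b \<in> ?I" for a b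
      using that by (auto simp flip: distrib_left)
    show "a * b \<in> ?I" if "a \<in> \<int>" "b \<in> ?I" for a b
      using that by (auto simp: mult.left_commute[of a])
    show "1 \<notin> ?I"
    proof
      assume "1 \<in> ?I"
      then obtain j where "(of_int 1 :: 'a) = of_int (m * j)"
        by (auto elim: Ints_cases)
      then have "m * j = 1"
        by (metis of_int_eq_iff)
      then show False
        using assms by (auto simp: zmult_eq_1_iff)
    qed
    have "\<exists>t\<in>of_int ` {0..<m}. of_int j - t \<in> ?I" for j
    proof (intro bexI)
      show "of_int j - of_int (j mod m) \<in> ?I"
        by (intro image_eqI[of _ _ "of_int (j div m)"])
          (simp_all add: minus_mod_eq_mult_div flip: of_int_diff of_int_mult)
      show "of_int (j mod m) \<in> of_int ` {0..<m}"
        using assms by simp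
    qed
    then have "\<forall>a\<in>\<int>. \<exists>t\<in>of_int ` {0..<m}. a - t \<in> ?I"
      by (auto elim: Ints_cases)
    then show "\<exists>T. finite T \<and> (\<forall>a\<in>\<int>. \<exists>t\<in>T. a - t \<in> ?I)"
      by blast
  qed
qed

lemma residually_finite_units_Ints:
  "residually_finite_units (\<int> :: 'a::{comm_ring_1, ring_char_0} set)"
  unfolding residually_finite_units_def
proof (intro ballI impI)
  fix a :: 'a assume "a \<in> \<int>" "a \<noteq> 0"
  then obtain k where k: "a = of_int k" "k \<noteq> 0"
    by (auto elim: Ints_cases)
  have "1 - a * of_int (- sgn k) = of_int (\<bar>k\<bar> + 1) * 1"
    by (simp add: k abs_sgn)
  then have "unit_mod \<int> ((*) (of_int (\<bar>k\<bar> + 1)) ` \<int>) a"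
    unfolding unit_mod_def by (metis Ints_1 Ints_of_int imageI)
  moreover have "\<bar>k\<bar> + 1 \<ge> 2"
    using k by simp
  ultimately show "\<exists>I. finite_index_ideal \<int> I \<and> unit_mod \<int> I a"
    using finite_index_ideal_Ints by blast
qed

text \<open>If \<open>x\<close> is transcendental over \<open>A\<close>, evaluation at any \<open>a \<in> A\<close> induces a homomorphism
  \<open>A[x] \<rightarrow> A\<close>, along which ideals are pulled back.\<close>

lemma (in finite_index_ideal) finite_index_ideal_specialization:
  assumes a: "a \<in> A" and inj: "inj_on (\<lambda>q. poly q x) (polys_over A)"
  shows "finite_index_ideal (adjoin A x) ((\<lambda>q. poly q x) ` {q \<in> polys_over A. poly q a \<in> I})"
proof -
  interpret polys: unital_subring "polys_over A"
    by (rule unital_subring_polys_over)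
  define \<phi> where "\<phi> b = poly (the_inv_into (polys_over A) (\<lambda>q. poly q x) b) a" for b
  have \<phi>: "\<phi> (poly q x) = poly q a" if "q \<in> polys_over A" for q
    using the_inv_into_f_f[OF inj that] by (simp add: \<phi>_def)
  have "finite_index_ideal (adjoin A x) {b \<in> adjoin A x. \<phi> b \<in> I}"
  proof (rule finite_index_ideal_vimage[OF unital_subring_adjoin])
    show "\<phi> \<in> adjoin A x \<rightarrow> A"
      using a by (auto simp: adjoin_def \<phi> poly_mem)
    show "\<phi> 1 = 1"
      using \<phi>[OF polys.one_mem] by simp
    show "\<phi> (b - c) = \<phi> b - \<phi> c" "\<phi> (b * c) = \<phi> b * \<phi> c"
      if "b \<in> adjoin A x" "c \<in> adjoin A x" for b c
      using that polys.diff_mem polys.mult_mem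
      by (auto simp: adjoin_def \<phi> simp flip: poly_diff poly_mult)
  qed
  moreover have "{b \<in> adjoin A x. \<phi> b \<in> I} =
      (\<lambda>q. poly q x) ` {q \<in> polys_over A. poly q a \<in> I}"
    by (auto simp: adjoin_def \<phi>)
  ultimately show ?thesis
    by simp
qed

lemma residually_finite_units_adjoin_transcendental:
  fixes A :: "'a::idom set"
  assumes "unital_subring A" "infinite A" and A: "residually_finite_units A"
    and inj: "inj_on (\<lambda>q. poly q x) (polys_over A)"
  shows "residually_finite_units (adjoin A x)"
  unfolding residually_finite_units_def
proof (intro ballI impI)
  interpret unital_subring A by fact
  interpret polys: unital_subring "polys_over A"
    by (rule unital_subring_polys_over)
  fix b assume "b \<in> adjoin A x" "b \<noteq> 0"
  then obtain \<beta> where \<beta>: "\<beta> \<in> polys_over A" "b = poly \<beta> x"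
    by (auto simp: adjoin_def)
  then have "finite {a. poly \<beta> a = 0}"
    using \<open>b \<noteq> 0\<close> by (intro poly_roots_finite) auto
  then obtain a where a: "a \<in> A" "poly \<beta> a \<noteq> 0"
    using \<open>infinite A\<close> finite_subset[of A "{a. poly \<beta> a = 0}"] by blast
  obtain I where I: "finite_index_ideal A I" "unit_mod A I (poly \<beta> a)"
    using residually_finite_unitsE[OF A poly_mem[OF \<beta>(1) a(1)] a(2)] .
  obtain u where u: "u \<in> A" "1 - poly \<beta> a * u \<in> I"
    using I(2) by (auto simp: unit_mod_def)
  define J where "J = (\<lambda>q. poly q x) ` {q \<in> polys_over A. poly q a \<in> I}"
  have const: "[:u:] \<in> polys_over A"
    using u(1) polys.zero_mem by (intro pCons_polys_over)
  have "1 - \<beta> * [:u:] \<in> polys_over A"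
    using \<beta>(1) const by (intro polys.diff_mem polys.mult_mem polys.one_mem)
  then have "1 - \<beta> * [:u:] \<in> {q \<in> polys_over A. poly q a \<in> I}"
    using u(2) by (simp add: mult.commute)
  then have "1 - b * poly [:u:] x \<in> J"
    unfolding J_def \<beta>(2) by (rule image_eqI[rotated]) simp
  then have "unit_mod (adjoin A x) J b"
    using poly_in_adjoin[OF const] unfolding unit_mod_def by blast
  moreover have "finite_index_ideal (adjoin A x) J"
    unfolding J_def using I(1) a(1) inj by (rule finite_index_ideal.finite_index_ideal_specialization)
  ultimately show "\<exists>J. finite_index_ideal (adjoin A x) J \<and> unit_mod (adjoin A x) J b"
    by blast
qed

locale minimal_polynomial = unital_subring A for A :: "'a::idom set" +
  fixes x :: 'a and g :: "'a poly"
  assumes g_mem: "g \<in> polys_over A"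
    and g_nonzero: "g \<noteq> 0"
    and root: "poly g x = 0"
    and minimal: "\<And>q. q \<in> polys_over A \<Longrightarrow> poly q x = 0 \<Longrightarrow> degree q < degree g \<Longrightarrow> q = 0"
begin

lemma degree_pos: "degree g > 0"
  using g_nonzero root by (auto intro!: gr0I elim!: degree_eq_zeroE)

lemma lead_coeff_mem: "lead_coeff g \<in> A"
  using g_mem by (rule polys_overD)

lemma pseudo_remainder:
  assumes "subring_ideal A I" "q \<in> polys_over I"
  obtains k s where "s \<in> polys_over I" "degree s < degree g"
    "poly s x = lead_coeff g ^ k * poly q x"
proof -
  obtain k h s where s: "s \<in> polys_over I" "smult (lead_coeff g ^ k) q = g * h + s"
    "s = 0 \<or> degree s < degree g"
    using subring_ideal.pseudo_division[OF assms(1) g_mem g_nonzero assms(2)] .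
  have "poly s x = lead_coeff g ^ k * poly q x"
    using arg_cong[OF s(2), of "\<lambda>p. poly p x"] root by simp
  then show ?thesis
    using s degree_pos by (intro that) auto
qed

lemma cofactor_nonzero:
  assumes h: "h \<in> polys_over A" and eq: "smult a g = s * h + t" and "a \<noteq> 0"
    and degrees: "degree t < degree s" "0 < degree s" "degree s < degree g"
  shows "poly h x \<noteq> 0"
proof -
  have "s * h = smult a g + (- t)"
    by (simp add: eq)
  also have "degree \<dots> = degree (smult a g)"
    using degrees \<open>a \<noteq> 0\<close> by (intro degree_add_eq_left) simp
  finally have degree_sh: "degree (s * h) = degree g"
    using \<open>a \<noteq> 0\<close> by simp
  then have "h \<noteq> 0" "s \<noteq> 0"
    using degree_pos by auto
  then have "degree h < degree g"
    using degree_sh degrees(2) by (simp add: degree_mult_eq)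
  then show ?thesis
    using minimal h \<open>h \<noteq> 0\<close> by blast
qed

text \<open>A step of the Euclidean algorithm for \<open>s\<close> and \<open>g\<close>.\<close>

lemma nonzero_multiple_of_smaller_degree:
  assumes s: "s \<in> polys_over A" "poly s x \<noteq> 0" "degree s > 0"
  shows "\<exists>t\<in>polys_over A. degree t < degree s \<and> poly t x \<noteq> 0 \<and>
    (\<exists>v\<in>adjoin A x. poly t x = poly s x * v)"
proof (cases "degree s < degree g")
  case False
  obtain k t where t: "t \<in> polys_over A" "degree t < degree g"
    "poly t x = lead_coeff g ^ k * poly s x"
    using pseudo_remainder[OF subring_ideal_self s(1)] .
  have "lead_coeff g ^ k \<in> adjoin A x"
    using subset_adjoin[OF zero_mem] power_mem[OF lead_coeff_mem] by blast
  moreover have "poly t x = poly s x * lead_coeff g ^ k" "poly t x \<noteq> 0"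
    using t(3) s(2) g_nonzero by (simp_all add: mult.commute)
  ultimately show ?thesis
    using t(1,2) False by (intro bexI[of _ t]) auto
next
  case True
  interpret adjoin: unital_subring "adjoin A x"
    by (rule unital_subring_adjoin)
  have "s \<noteq> 0"
    using s by auto
  obtain k h t where t: "h \<in> polys_over A" "t \<in> polys_over A"
    "smult (lead_coeff s ^ k) g = s * h + t" "t = 0 \<or> degree t < degree s"
    using subring_ideal.pseudo_division[OF subring_ideal_self s(1) \<open>s \<noteq> 0\<close> g_mem] .
  have degree_t: "degree t < degree s"
    using t(4) s(3) by auto
  have "poly h x \<noteq> 0"
    using cofactor_nonzero[OF t(1,3)] \<open>s \<noteq> 0\<close> degree_t s(3) True by simp
  moreover have "poly t x = poly s x * (- poly h x)"
    using arg_cong[OF t(3), of "\<lambda>p. poly p x"] root by (simp add: add_eq_0_iff)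
  moreover have "- poly h x \<in> adjoin A x"
    using t(1) by (intro adjoin.minus_mem poly_in_adjoin)
  ultimately show ?thesis
    using t(2) degree_t s(2) by (metis mult_eq_0_iff neg_equal_0_iff_equal)
qed

lemma nonzero_multiple_in_base:
  assumes "s \<in> polys_over A" "poly s x \<noteq> 0"
  shows "\<exists>v\<in>adjoin A x. poly s x * v \<in> A - {0}"
  using assms
proof (induction "degree s" arbitrary: s rule: less_induct)
  case less
  interpret adjoin: unital_subring "adjoin A x"
    by (rule unital_subring_adjoin)
  show ?case
  proof (cases "degree s = 0")
    case True
    then obtain e where "s = [:e:]"
      by (rule degree_eq_zeroE)
    then show ?thesis
      using less.prems polys_overD[of s A 0] adjoin.one_mem by (intro bexI[of _ 1]) auto
  next
    case False
    then obtain t v where t: "t \<in> polys_over A" "degree t < degree s" "poly t x \<noteq> 0"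
      and v: "v \<in> adjoin A x" "poly t x = poly s x * v"
      using nonzero_multiple_of_smaller_degree[OF less.prems] by auto
    obtain w where "w \<in> adjoin A x" "poly t x * w \<in> A - {0}"
      using less.hyps[OF t(2,1,3)] by blast
    then show ?thesis
      using v by (metis adjoin.mult_mem mult.assoc)
  qed
qed

text \<open>Pseudo-division by \<open>g\<close> keeps all coefficients in \<open>I\<close>, so \<open>1 \<in> I[x]\<close> would put a power of
  the leading coefficient of \<open>g\<close> into \<open>I\<close>.\<close>

lemma proper_adjoin_ideal:
  assumes "finite_index_ideal A I" and "unit_mod A I (lead_coeff g)"
  shows "1 \<notin> adjoin I x"
proof
  interpret finite_index_ideal A I by fact
  interpret polys: unital_subring "polys_over A"
    by (rule unital_subring_polys_over)
  assume "1 \<in> adjoin I x"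
  then obtain i where i: "i \<in> polys_over I" "poly i x = 1"
    by (auto simp: adjoin_def)
  obtain k s where s: "s \<in> polys_over I" "degree s < degree g"
    "poly s x = lead_coeff g ^ k * poly i x"
    using pseudo_remainder[OF subring_ideal_axioms i(1)] .
  have "[:lead_coeff g ^ k:] - s = 0"
  proof (rule minimal)
    show "[:lead_coeff g ^ k:] - s \<in> polys_over A"
      using s(1) polys_over_mono[OF subset] power_mem[OF lead_coeff_mem] polys.zero_mem
      by (intro polys.diff_mem pCons_polys_over) auto
    show "degree ([:lead_coeff g ^ k:] - s) < degree g"
      using s(2) by (intro degree_diff_less) auto
  qed (use s(3) i(2) in simp)
  then have "lead_coeff g ^ k \<in> I"
    using polys_overD[OF s(1), of 0] by auto
  then show False
    using unit_mod_not_mem unit_mod_power assms(2) lead_coeff_mem by blast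
qed

lemma reduce_degree_mod_ideal:
  assumes "subring_ideal A I" and "unit_mod A I (lead_coeff g)" and q: "q \<in> polys_over A"
  obtains s where "s \<in> polys_over A" "degree s < degree g" "poly q x - poly s x \<in> adjoin I x"
proof -
  interpret subring_ideal A I by fact
  interpret adjoin: subring_ideal "adjoin A x" "adjoin I x"
    by (rule subring_ideal_adjoin)
  obtain u where u: "u \<in> A" "1 - lead_coeff g * u \<in> I"
    using assms(2) by (auto simp: unit_mod_def)
  obtain k s where s: "s \<in> polys_over A" "degree s < degree g"
    "poly s x = lead_coeff g ^ k * poly q x"
    using pseudo_remainder[OF subring_ideal_self q] .
  have "poly q x - poly (smult (u ^ k) s) x = (1 - (lead_coeff g * u) ^ k) * poly q x"
    by (simp add: s(3) power_mult_distrib algebra_simps)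
  moreover have "1 - (lead_coeff g * u) ^ k \<in> adjoin I x"
    using power_cong_one[OF u(2)] u(1) lead_coeff_mem subset_adjoin[OF zero_ideal]
    by (auto intro: mult_mem)
  ultimately have "poly q x - poly (smult (u ^ k) s) x \<in> adjoin I x"
    using poly_in_adjoin[OF q] by (simp add: adjoin.mult_ideal_right)
  moreover have "smult (u ^ k) s \<in> polys_over A"
    using s(1) u(1) by (auto simp: polys_over_def intro: mult_mem power_mem)
  ultimately show ?thesis
    using that s(2) by (meson degree_smult_le le_less_trans)
qed

end

lemma (in finite_index_ideal) finite_representatives_bounded_degree:
  "\<exists>T. finite T \<and> (\<forall>s\<in>polys_over A. degree s < n \<longrightarrow> (\<exists>t\<in>T. poly s x - t \<in> adjoin I x))"
proof -
  obtain T where T: "finite T" "\<forall>a\<in>A. \<exists>t\<in>T. a - t \<in> I"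
    using finite_index by blast
  then obtain rep where rep: "\<And>a. a \<in> A \<Longrightarrow> rep a \<in> T \<and> a - rep a \<in> I"
    by metis
  define S where "S = (\<lambda>f. \<Sum>j<n. f j * x ^ j) ` ({..<n} \<rightarrow>\<^sub>E T)"
  have "\<exists>t\<in>S. poly s x - t \<in> adjoin I x" if s: "s \<in> polys_over A" "degree s < n" for s
  proof -
    define f where "f = (\<lambda>j\<in>{..<n}. rep (coeff s j))"
    define e where "e = (\<Sum>j<n. monom (coeff s j - f j) j)"
    have "poly s x = (\<Sum>j<n. coeff s j * x ^ j)"
      unfolding poly_altdef using s(2)
      by (intro sum.mono_neutral_left) (auto simp: coeff_eq_0)
    then have "poly s x - (\<Sum>j<n. f j * x ^ j) = poly e x"
      by (simp add: e_def poly_sum poly_monom sum_subtractf left_diff_distrib)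
    moreover have "coeff e j \<in> I" for j
      using rep[OF polys_overD[OF s(1)]]
      by (auto simp: e_def f_def coeff_sum coeff_monom zero_ideal)
    then have "e \<in> polys_over I"
      by (rule polys_overI)
    moreover have "(\<Sum>j<n. f j * x ^ j) \<in> S"
      unfolding S_def f_def using rep[OF polys_overD[OF s(1)]]
      by (intro imageI restrict_PiE_iff[THEN iffD2]) blast
    ultimately show ?thesis
      using poly_in_adjoin by metis
  qed
  moreover have "finite S"
    unfolding S_def using T(1) by (intro finite_imageI finite_PiE) auto
  ultimately show ?thesis
    by blast
qed

context minimal_polynomial
begin

lemma finite_index_ideal_adjoin:
  assumes I: "finite_index_ideal A I" and unit: "unit_mod A I (lead_coeff g)"
  shows "finite_index_ideal (adjoin A x) (adjoin I x)"
proof -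
  interpret finite_index_ideal A I by fact
  interpret adjoin: subring_ideal "adjoin A x" "adjoin I x"
    by (rule subring_ideal_adjoin)
  obtain T where T: "finite T" "\<And>s. s \<in> polys_over A \<Longrightarrow> degree s < degree g \<Longrightarrow>
      \<exists>t\<in>T. poly s x - t \<in> adjoin I x"
    using finite_representatives_bounded_degree by metis
  have "\<exists>t\<in>T. a - t \<in> adjoin I x" if a: "a \<in> adjoin A x" for a
  proof -
    obtain q where q: "q \<in> polys_over A" "a = poly q x"
      using a by (auto simp: adjoin_def)
    obtain s where s: "s \<in> polys_over A" "degree s < degree g" "a - poly s x \<in> adjoin I x"
      using reduce_degree_mod_ideal[OF subring_ideal_axioms unit q(1)] q(2) by blast
    obtain t where t: "t \<in> T" "poly s x - t \<in> adjoin I x"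
      using T(2)[OF s(1,2)] by blast
    have "(a - poly s x) + (poly s x - t) \<in> adjoin I x"
      using s(3) t(2) by (rule adjoin.add_ideal)
    then show ?thesis
      using t(1) by auto
  qed
  then show ?thesis
    using T(1) by unfold_locales (auto simp: proper_adjoin_ideal[OF I unit])
qed

lemma residually_finite_units_adjoin_algebraic:
  assumes A: "residually_finite_units A"
  shows "residually_finite_units (adjoin A x)"
  unfolding residually_finite_units_def
proof (intro ballI impI)
  interpret adjoin: unital_subring "adjoin A x"
    by (rule unital_subring_adjoin)
  fix b assume "b \<in> adjoin A x" "b \<noteq> 0"
  then obtain v where v: "v \<in> adjoin A x" "b * v \<in> A" "b * v \<noteq> 0"
    using nonzero_multiple_in_base by (auto simp: adjoin_def)
  define a where "a = lead_coeff g * (b * v)"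
  have "a \<in> A" "a \<noteq> 0"
    using v lead_coeff_mem g_nonzero by (auto simp: a_def intro: mult_mem)
  then obtain I where I: "finite_index_ideal A I" "unit_mod A I a"
    using residually_finite_unitsE[OF A] by blast
  interpret finite_index_ideal A I by fact
  have "unit_mod A I (lead_coeff g)"
    using unit_mod_factor I(2) v(2) unfolding a_def by blast
  then have "finite_index_ideal (adjoin A x) (adjoin I x)"
    using I(1) finite_index_ideal_adjoin by blast
  have "unit_mod (adjoin A x) (adjoin I x) a"
    using I(2) subset_adjoin[OF zero_mem] subset_adjoin[OF zero_ideal]
    unfolding unit_mod_def by blast
  moreover have "a = b * (v * lead_coeff g)"
    by (simp add: a_def mult_ac)
  moreover have "v * lead_coeff g \<in> adjoin A x"
    using v(1) lead_coeff_mem subset_adjoin[OF zero_mem] by (blast intro: adjoin.mult_mem)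
  ultimately have "unit_mod (adjoin A x) (adjoin I x) b"
    using adjoin.unit_mod_factor by metis
  then show "\<exists>J. finite_index_ideal (adjoin A x) J \<and> unit_mod (adjoin A x) J b"
    using \<open>finite_index_ideal (adjoin A x) (adjoin I x)\<close> by blast
qed

end

lemma minimal_polynomial_exists:
  fixes A :: "'a::idom set"
  assumes "unital_subring A" and "\<not> inj_on (\<lambda>q. poly q x) (polys_over A)"
  shows "\<exists>g. minimal_polynomial A x g"
proof -
  interpret unital_subring A by fact
  interpret polys: unital_subring "polys_over A"
    by (rule unital_subring_polys_over)
  define root where "root q \<longleftrightarrow> q \<in> polys_over A \<and> q \<noteq> 0 \<and> poly q x = 0" for q
  obtain p q where "p \<in> polys_over A" "q \<in> polys_over A" "poly p x = poly q x" "p \<noteq> q"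
    using assms(2) by (auto simp: inj_on_def)
  then have "root (p - q)"
    by (simp add: root_def polys.diff_mem)
  then obtain g where "root g" and least: "\<And>q. root q \<Longrightarrow> degree g \<le> degree q"
    using ex_has_least_nat[of root _ degree] by blast
  have "q = 0" if "q \<in> polys_over A" "poly q x = 0" "degree q < degree g" for q
    using least[of q] that by (auto simp: root_def)
  then have "minimal_polynomial A x g"
    using \<open>root g\<close> by unfold_locales (auto simp: root_def)
  then show ?thesis ..
qed

lemma residually_finite_units_adjoin:
  fixes A :: "'a::idom set"
  assumes "unital_subring A" "infinite A" "residually_finite_units A"
  shows "residually_finite_units (adjoin A x)"
  using residually_finite_units_adjoin_transcendental[OF assms]
    minimal_polynomial.residually_finite_units_adjoin_algebraic[OF _ assms(3)]
    minimal_polynomial_exists[OF assms(1)] by blast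

lemma infinite_Ints: "infinite (\<int> :: 'a::ring_char_0 set)"
  by (simp add: Ints_def finite_image_iff inj_on_def infinite_UNIV_int)

lemma residually_finite_units_finitely_generated:
  fixes S :: "'a::{idom, ring_char_0} set"
  assumes "finite S"
  obtains A where "unital_subring A" "S \<subseteq> A" "residually_finite_units A"
proof -
  have "\<exists>A. unital_subring A \<and> infinite A \<and> S \<subseteq> A \<and> residually_finite_units A"
    using assms
  proof (induction S)
    case empty
    then show ?case
      using unital_subring_Ints infinite_Ints residually_finite_units_Ints by blast
  next
    case (insert x S)
    then obtain A where "unital_subring A" and A: "infinite A" "S \<subseteq> A" "residually_finite_units A"
      by blast
    interpret unital_subring A by fact
    have "A \<subseteq> adjoin A x"
      using zero_mem by (rule subset_adjoin)
    then have "infinite (adjoin A x)" "insert x S \<subseteq> adjoin A x"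
      using A adjoin_generator finite_subset by blast+
    then show ?case
      using unital_subring_adjoin residually_finite_units_adjoin[OF unital_subring_axioms A(1,3)]
      by blast
  qed
  then show ?thesis
    using that by blast
qed

section \<open>Exponential sums modulo an ideal of finite index\<close>

definition subring_units :: "'a::field set \<Rightarrow> 'a set" where
  "subring_units A = {z \<in> A. z \<noteq> 0 \<and> inverse z \<in> A}"

lemma power_int_mem_subring:
  assumes "unital_subring A" "z \<in> subring_units A"
  shows "z powi k \<in> A"
  using assms by (auto simp: power_int_def subring_units_def intro: unital_subring.power_mem)

lemma power_int_cong_one:
  assumes "subring_ideal A I" and z: "z \<in> subring_units A" and N: "1 - z ^ N \<in> I"
  shows "1 - z powi (int N * k) \<in> I"
proof -
  interpret subring_ideal A I by fact
  have "z \<noteq> 0" and z_mem: "z powi l \<in> A" for l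
    using z power_int_mem_subring[OF unital_subring_axioms z] by (auto simp: subring_units_def)
  have nonneg_multiple: "1 - z powi (int N * int n) \<in> I" for n
    using power_cong_one[OF N, of n] z_mem[of "int N"] by (simp add: power_int_mult)
  show ?thesis
  proof (cases k)
    case (nonneg n)
    then show ?thesis
      using nonneg_multiple by simp
  next
    case (neg n)
    have "z powi (int N * k) * z powi (int N * int (Suc n)) = 1"
      using \<open>z \<noteq> 0\<close> by (simp add: neg flip: power_int_add distrib_left)
    then have "1 - z powi (int N * k) = - (z powi (int N * k)) * (1 - z powi (int N * int (Suc n)))"
      by (simp add: right_diff_distrib)
    then show ?thesis
      using nonneg_multiple[of "Suc n"] z_mem by (metis minus_mem mult_ideal)
  qed
qed

lemma (in finite_index_ideal) power_cong_one_of_unit: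
  assumes z: "z \<in> A" and w: "w \<in> A" and zw: "z * w = 1"
  shows "\<exists>N>0. 1 - z ^ N \<in> I"
proof -
  obtain T where T: "finite T" "\<And>a. a \<in> A \<Longrightarrow> \<exists>t\<in>T. a - t \<in> I"
    using finite_index by blast
  obtain t where t: "\<And>n::nat. t n \<in> T \<and> z ^ n - t n \<in> I"
    using T(2)[OF power_mem[OF z]] by metis
  have "\<not> inj t"
    using T(1) t by (metis finite_subset image_subsetI infinite_UNIV_nat finite_imageD)
  then obtain a b where ab: "t a = t b" "a < b"
    by (metis injI linorder_neqE_nat)
  have "(z ^ a - t a) - (z ^ b - t b) \<in> I"
    using t by (intro diff_ideal[of "_ - _" "_ - _"]) auto
  then have "w ^ a * (z ^ a - z ^ b) \<in> I"
    using ab(1) w by (simp add: mult_ideal power_mem)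
  moreover have "z ^ b = z ^ a * z ^ (b - a)"
    using ab(2) by (simp flip: power_add)
  then have "w ^ a * (z ^ a - z ^ b) = (z * w) ^ a * (1 - z ^ (b - a))"
    by (simp add: power_mult_distrib algebra_simps)
  ultimately show ?thesis
    using ab(2) zw by (intro exI[of _ "b - a"]) simp
qed

lemma common_period_of_units:
  assumes I: "finite_index_ideal A I" and "finite Z" and Z: "Z \<subseteq> subring_units A"
  shows "\<exists>N>0. \<forall>z\<in>Z. \<forall>k. 1 - z powi (int N * k) \<in> I"
proof -
  interpret finite_index_ideal A I by fact
  have "\<exists>n>0. 1 - z ^ n \<in> I" if "z \<in> Z" for z
    using Z that by (intro power_cong_one_of_unit[of z "inverse z"]) (auto simp: subring_units_def)
  then obtain n where n: "\<And>z. z \<in> Z \<Longrightarrow> n z > 0 \<and> 1 - z ^ n z \<in> I"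
    by metis
  have "1 - z powi (int (prod n Z) * k) \<in> I" if z: "z \<in> Z" for z k
  proof -
    obtain m where m: "prod n Z = n z * m"
      using dvd_prodI[OF \<open>finite Z\<close> z, of n] by blast
    show ?thesis
      using power_int_cong_one[OF subring_ideal_axioms, of z "n z" "int m * k"] n[OF z] Z z
      by (auto simp: m mult.assoc)
  qed
  moreover have "prod n Z > 0"
    using n by (simp add: prod_pos)
  ultimately show ?thesis
    by blast
qed

definition exponential_sum ::
    "'i set \<Rightarrow> 'j set \<Rightarrow> ('i \<Rightarrow> 'a::field) \<Rightarrow> ('i \<Rightarrow> 'j \<Rightarrow> 'a) \<Rightarrow> ('j \<Rightarrow> int) \<Rightarrow> 'a" where
  "exponential_sum S R c z m = (\<Sum>i\<in>S. c i * (\<Prod>j\<in>R. z i j powi m j))"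

lemma exponential_sum_mem:
  assumes "unital_subring A" and "c ` S \<subseteq> A" and "\<And>i j. i \<in> S \<Longrightarrow> j \<in> R \<Longrightarrow> z i j \<in> subring_units A"
  shows "exponential_sum S R c z m \<in> A"
proof -
  interpret unital_subring A by fact
  show ?thesis
    unfolding exponential_sum_def using assms(2,3)
    by (intro sum_mem mult_mem prod_mem power_int_mem_subring[OF assms(1)]) auto
qed

lemma exponential_sum_cong_shift:
  assumes "subring_ideal A I" and c: "c ` S \<subseteq> A"
    and z: "\<And>i j. i \<in> S \<Longrightarrow> j \<in> R \<Longrightarrow> z i j \<in> subring_units A"
    and l: "\<And>i j. i \<in> S \<Longrightarrow> j \<in> R \<Longrightarrow> 1 - z i j powi l j \<in> I"
  shows "exponential_sum S R c z m - exponential_sum S R c z (\<lambda>j. m j + l j) \<in> I"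
proof -
  interpret subring_ideal A I by fact
  have z_mem: "z i j powi k \<in> A" if "i \<in> S" "j \<in> R" for i j k
    using power_int_mem_subring[OF unital_subring_axioms z[OF that]] .
  have "z i j \<noteq> 0" if "i \<in> S" "j \<in> R" for i j
    using z[OF that] by (auto simp: subring_units_def)
  then have "exponential_sum S R c z m - exponential_sum S R c z (\<lambda>j. m j + l j) =
      (\<Sum>i\<in>S. c i * (\<Prod>j\<in>R. z i j powi m j) * (1 - (\<Prod>j\<in>R. z i j powi l j)))"
    unfolding exponential_sum_def sum_subtractf[symmetric]
    by (intro sum.cong) (auto simp: power_int_add prod.distrib algebra_simps)
  also have "\<dots> \<in> I"
    using c l by (intro sum_ideal mult_ideal mult_mem prod_mem prod_cong_one z_mem) auto
  finally show ?thesis .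
qed

lemma exponential_sum_nonzero_on_coset:
  fixes c :: "'i \<Rightarrow> 'a::field_char_0"
  assumes fin: "finite S" "finite R"
    and z: "\<And>i j. i \<in> S \<Longrightarrow> j \<in> R \<Longrightarrow> z i j \<noteq> 0"
    and nonzero: "exponential_sum S R c z m \<noteq> 0"
  shows "\<exists>N>0. \<forall>k. exponential_sum S R c z (\<lambda>j. m j + int N * k j) \<noteq> 0"
proof -
  define Z where "Z = case_prod z ` (S \<times> R)"
  have "finite Z"
    using fin by (simp add: Z_def)
  then have "finite (c ` S \<union> Z \<union> inverse ` Z)"
    using fin by simp
  then obtain A where A: "unital_subring A" "c ` S \<union> Z \<union> inverse ` Z \<subseteq> A"
    "residually_finite_units A"
    by (rule residually_finite_units_finitely_generated)
  have "0 \<notin> Z"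
    using z by (auto simp: Z_def)
  then have Z_units: "Z \<subseteq> subring_units A"
    using A(2) by (auto simp: subring_units_def)
  then have units: "z i j \<in> subring_units A" if "i \<in> S" "j \<in> R" for i j
    using that by (auto simp: Z_def)
  have c: "c ` S \<subseteq> A"
    using A(2) by blast
  obtain I where I: "finite_index_ideal A I" "unit_mod A I (exponential_sum S R c z m)"
    using residually_finite_unitsE[OF A(3) exponential_sum_mem[OF A(1) c units] nonzero] .
  interpret finite_index_ideal A I by fact
  obtain N where N: "N > 0" "\<And>y k. y \<in> Z \<Longrightarrow> 1 - y powi (int N * k) \<in> I"
    using common_period_of_units[OF I(1) \<open>finite Z\<close> Z_units] by blast
  have "exponential_sum S R c z m - exponential_sum S R c z (\<lambda>j. m j + int N * k j) \<in> I" for k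
    using N(2) by (intro exponential_sum_cong_shift[OF subring_ideal_axioms c units])
      (auto simp: Z_def)
  then have "exponential_sum S R c z (\<lambda>j. m j + int N * k j) \<noteq> 0" for k
    using unit_mod_not_mem[OF I(2)] by (metis diff_zero)
  then show ?thesis
    using N(1) by blast
qed

section \<open>The dual group\<close>

lemma characters_norm: "\<chi> \<in> characters \<Longrightarrow> norm (\<chi> x) = 1"
  and characters_add: "\<chi> \<in> characters \<Longrightarrow> \<chi> (x + y) = \<chi> x * \<chi> y"
  by (auto simp: characters_def)

lemma characters_nonzero: "\<chi> \<in> characters \<Longrightarrow> \<chi> x \<noteq> 0"
  using characters_norm[of \<chi> x] by auto

lemma characters_zero: "\<chi> \<in> characters \<Longrightarrow> \<chi> 0 = 1"
  using characters_add[of \<chi> 0 0] characters_nonzero[of \<chi> 0] by simp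

lemma characters_one: "(\<lambda>_. 1) \<in> characters"
  by (simp add: characters_def)

lemma characters_mult:
  "\<chi> \<in> characters \<Longrightarrow> \<psi> \<in> characters \<Longrightarrow> (\<lambda>x. \<chi> x * \<psi> x) \<in> characters"
  by (simp add: characters_def norm_mult)

lemma characters_inverse: "\<chi> \<in> characters \<Longrightarrow> (\<lambda>x. inverse (\<chi> x)) \<in> characters"
  by (simp add: characters_def norm_inverse)

lemma character_power_card:
  fixes \<chi> :: "'f::{ab_group_add, finite} \<Rightarrow> complex"
  assumes \<chi>: "\<chi> \<in> characters"
  shows "\<chi> x ^ card (UNIV :: 'f set) = 1"
proof -
  have "(\<Prod>y\<in>UNIV. \<chi> y) = (\<Prod>y\<in>UNIV. \<chi> (x + y))"
    using prod.reindex_bij_betw[OF bij_plus[of x], of \<chi>] by simp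
  also have "\<dots> = \<chi> x ^ card (UNIV :: 'f set) * (\<Prod>y\<in>UNIV. \<chi> y)"
    by (simp add: characters_add[OF \<chi>] prod.distrib)
  finally show ?thesis
    using characters_nonzero[OF \<chi>] by simp
qed

lemma finite_characters: "finite (characters :: ('f::{ab_group_add, finite} \<Rightarrow> complex) set)"
proof (rule finite_subset)
  let ?roots = "{w :: complex. w ^ card (UNIV :: 'f set) = 1}"
  show "(characters :: ('f \<Rightarrow> complex) set) \<subseteq>
      {\<chi>. \<forall>x. (x \<in> UNIV \<longrightarrow> \<chi> x \<in> ?roots) \<and> (x \<notin> UNIV \<longrightarrow> \<chi> x = 0)}"
    by (auto simp: character_power_card)
  show "finite {\<chi> :: 'f \<Rightarrow> complex. \<forall>x. (x \<in> UNIV \<longrightarrow> \<chi> x \<in> ?roots) \<and> (x \<notin> UNIV \<longrightarrow> \<chi> x = 0)}"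
    by (intro finite_set_of_finite_funs finite_roots_unity) (simp_all add: Suc_le_eq card_gt_0_iff)
qed

lemma carrier_dual_group [simp]: "carrier (dual_group r) = dual_carrier r"
  and one_dual_group [simp]: "\<one>\<^bsub>dual_group r\<^esub> = ((\<lambda>_. 1), (\<lambda>_. 0))"
  and mult_dual_group [simp]:
    "a \<otimes>\<^bsub>dual_group r\<^esub> b = ((\<lambda>x. fst a x * fst b x), (\<lambda>i. snd a i + snd b i))"
  by (simp_all add: dual_group_def)

lemma mem_dual_carrier [simp]:
  "(\<chi>, m) \<in> dual_carrier r \<longleftrightarrow> \<chi> \<in> characters \<and> (\<forall>i\<ge>r. m i = 0)"
  by (simp add: dual_carrier_def)

lemma comm_group_dual_group: "comm_group (dual_group r)"
proof (rule comm_groupI)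
  fix a assume "a \<in> carrier (dual_group r)"
  moreover obtain \<chi> m where a: "a = (\<chi>, m)"
    by (cases a)
  ultimately have "\<chi> \<in> characters" "\<forall>i\<ge>r. m i = 0"
    by auto
  then show "\<exists>b\<in>carrier (dual_group r). b \<otimes>\<^bsub>dual_group r\<^esub> a = \<one>\<^bsub>dual_group r\<^esub>"
    unfolding a
    by (intro bexI[of _ "((\<lambda>x. inverse (\<chi> x)), (\<lambda>i. - m i))"])
      (auto simp: characters_inverse characters_nonzero)
qed (auto simp: dual_carrier_def characters_one characters_mult mult_ac add_ac)

lemma inv_dual_group:
  assumes "(\<chi>, m) \<in> dual_carrier r"
  shows "inv\<^bsub>dual_group r\<^esub> (\<chi>, m) = ((\<lambda>x. inverse (\<chi> x)), (\<lambda>i. - m i))"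
  using assms
  by (intro group.inv_equality comm_group.axioms(2)[OF comm_group_dual_group])
    (auto simp: characters_inverse characters_nonzero)

lemma nat_pow_dual_group:
  "((\<lambda>_. 1), m) [^]\<^bsub>dual_group r\<^esub> (n::nat) = ((\<lambda>_. 1), (\<lambda>i. int n * m i))"
  by (induction n) (auto simp: nat_pow_def dual_group_def algebra_simps)

definition congruence_subgroup :: "nat \<Rightarrow> nat \<Rightarrow> (('f::ab_group_add \<Rightarrow> complex) \<times> (nat \<Rightarrow> int)) set" where
  "congruence_subgroup r N = {\<lambda>_. 1} \<times> {m. (\<forall>i\<ge>r. m i = 0) \<and> (\<forall>i. int N dvd m i)}"

lemma mem_coset_congruence_subgroup:
  "(\<chi>', m') \<in> (\<chi>, m) <#\<^bsub>dual_group r\<^esub> congruence_subgroup r N \<longleftrightarrow>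
    \<chi>' = \<chi> \<and> (\<forall>i\<ge>r. m' i = m i) \<and> (\<forall>i. int N dvd m' i - m i)"
proof
  assume R: "\<chi>' = \<chi> \<and> (\<forall>i\<ge>r. m' i = m i) \<and> (\<forall>i. int N dvd m' i - m i)"
  then have "((\<lambda>_. 1), (\<lambda>i. m' i - m i)) \<in> congruence_subgroup r N"
    by (simp add: congruence_subgroup_def)
  with R show "(\<chi>', m') \<in> (\<chi>, m) <#\<^bsub>dual_group r\<^esub> congruence_subgroup r N"
    by (force simp: l_coset_def)
qed (auto simp: l_coset_def congruence_subgroup_def)

lemma subgroup_congruence_subgroup: "subgroup (congruence_subgroup r N) (dual_group r)"
proof -
  interpret comm_group "dual_group r"
    by (rule comm_group_dual_group)
  show ?thesis
    by (rule subgroupI)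
      (auto simp: congruence_subgroup_def characters_one inv_dual_group intro: exI[of _ "\<lambda>_. 0"])
qed

lemma finite_rcosets_congruence_subgroup:
  assumes "N > 0"
  shows "finite (rcosets\<^bsub>dual_group r\<^esub>
    (congruence_subgroup r N :: (('f::{ab_group_add, finite} \<Rightarrow> complex) \<times> (nat \<Rightarrow> int)) set))"
proof -
  let ?G = "dual_group r :: (('f \<Rightarrow> complex) \<times> (nat \<Rightarrow> int)) monoid"
  let ?H = "congruence_subgroup r N :: (('f \<Rightarrow> complex) \<times> (nat \<Rightarrow> int)) set"
  interpret comm_group ?G
    by (rule comm_group_dual_group)
  let ?M = "{m. \<forall>i. (i \<in> {..<r} \<longrightarrow> m i \<in> {0..<int N}) \<and> (i \<notin> {..<r} \<longrightarrow> m i = 0)}"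
  have "rcosets\<^bsub>?G\<^esub> ?H \<subseteq> (\<lambda>a. a <#\<^bsub>?G\<^esub> ?H) ` (characters \<times> ?M)"
  proof
    fix C assume "C \<in> rcosets\<^bsub>?G\<^esub> ?H"
    then obtain \<chi> m where \<chi>: "\<chi> \<in> characters" and m: "\<forall>i\<ge>r. m i = 0" and C: "C = ?H #>\<^bsub>?G\<^esub> (\<chi>, m)"
      by (auto simp: RCOSETS_def)
    define m' where "m' i = m i mod int N" for i
    have "(\<chi>, m') \<in> (\<chi>, m) <#\<^bsub>?G\<^esub> ?H"
      using m by (simp add: mem_coset_congruence_subgroup m'_def mod_eq_dvd_iff[symmetric])
    moreover have "C = (\<chi>, m) <#\<^bsub>?G\<^esub> ?H"
      using C \<chi> m normal.coset_eq[OF subgroup_imp_normal[OF subgroup_congruence_subgroup]] by simp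
    ultimately have "C = (\<chi>, m') <#\<^bsub>?G\<^esub> ?H"
      using \<chi> m l_repr_independence[OF _ _ subgroup_congruence_subgroup] by simp
    moreover have "m' \<in> ?M"
      using m assms by (auto simp: m'_def)
    ultimately show "C \<in> (\<lambda>a. a <#\<^bsub>?G\<^esub> ?H) ` (characters \<times> ?M)"
      using \<chi> by blast
  qed
  moreover have "finite ?M"
    by (rule finite_set_of_finite_funs) auto
  ultimately show ?thesis
    using finite_characters by (meson finite_SigmaI finite_imageI finite_subset)
qed

lemma (in comm_group) finite_index_pow_mem:
  assumes H: "subgroup H G" and fin: "finite (rcosets H)"
  shows "\<exists>N>0. \<forall>g\<in>carrier G. g [^] (N::nat) \<in> H"
proof -
  interpret normal H G
    using H by (rule subgroup_imp_normal)
  interpret Q: group "G Mod H"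
    by (rule factorgroup_is_group)
  define n where "n = Coset.order (G Mod H)"
  have "g [^] n \<in> H" if g: "g \<in> carrier G" for g
  proof -
    have hom: "(\<lambda>a. H #> a) \<in> hom G (G Mod H)"
      by (rule r_coset_hom_Mod)
    have "H #> (g [^] n) = (H #> g) [^]\<^bsub>G Mod H\<^esub> n"
      using hom_nat_pow[OF hom g group_axioms Q.group_axioms] by simp
    also have "\<dots> = \<one>\<^bsub>G Mod H\<^esub>"
      unfolding n_def using hom g by (intro Q.pow_order_eq_1) (auto simp: hom_def)
    finally have "H #> (g [^] n) = H"
      by (simp add: FactGroup_def)
    then show ?thesis
      using rcos_self[OF nat_pow_closed[OF g] H] by metis
  qed
  moreover have "n > 0"
    using fin Q.order_gt_0_iff_finite by (simp add: n_def FactGroup_def)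
  ultimately show ?thesis
    by blast
qed

lemma congruence_subgroup_subset:
  assumes "subgroup H (dual_group r)" "finite (rcosets\<^bsub>dual_group r\<^esub> H)"
  shows "\<exists>N>0. congruence_subgroup r N \<subseteq> H"
proof -
  obtain N where N: "N > 0" "\<And>g. g \<in> dual_carrier r \<Longrightarrow> g [^]\<^bsub>dual_group r\<^esub> (N::nat) \<in> H"
    using comm_group.finite_index_pow_mem[OF comm_group_dual_group assms] by auto
  have "((\<lambda>_. 1), m) \<in> H" if m: "\<forall>i\<ge>r. m i = 0" "\<forall>i. int N dvd m i" for m
  proof -
    have "((\<lambda>_. 1), (\<lambda>i. m i div int N)) \<in> dual_carrier r"
      using m by (simp add: characters_one)
    from N(2)[OF this] show ?thesis
      using m by (simp add: nat_pow_dual_group)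
  qed
  then show ?thesis
    using N(1) by (auto simp: congruence_subgroup_def)
qed

lemma ubiquitous_iff_meets_congruence_cosets:
  fixes K :: "(('f::{ab_group_add, finite} \<Rightarrow> complex) \<times> (nat \<Rightarrow> int)) set"
  shows "ubiquitous r K \<longleftrightarrow>
    (\<forall>N>0. \<forall>\<gamma>\<in>dual_carrier r. (\<gamma> <#\<^bsub>dual_group r\<^esub> congruence_subgroup r N) \<inter> K \<noteq> {})"
proof
  assume "ubiquitous r K"
  then show "\<forall>N>0. \<forall>\<gamma>\<in>dual_carrier r. (\<gamma> <#\<^bsub>dual_group r\<^esub> congruence_subgroup r N) \<inter> K \<noteq> {}"
    using subgroup_congruence_subgroup finite_rcosets_congruence_subgroup
    unfolding ubiquitous_def by blast
next
  assume meets: "\<forall>N>0. \<forall>\<gamma>\<in>dual_carrier r. (\<gamma> <#\<^bsub>dual_group r\<^esub> congruence_subgroup r N) \<inter> K \<noteq> {}"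
  show "ubiquitous r K"
    unfolding ubiquitous_def
  proof (intro allI impI, elim conjE)
    fix H :: "(('f \<Rightarrow> complex) \<times> (nat \<Rightarrow> int)) set"
      and \<gamma> :: "('f \<Rightarrow> complex) \<times> (nat \<Rightarrow> int)"
    assume "subgroup H (dual_group r)" "finite (rcosets\<^bsub>dual_group r\<^esub> H)"
      and \<gamma>: "\<gamma> \<in> dual_carrier r"
    then obtain N where N: "N > 0" "congruence_subgroup r N \<subseteq> H"
      using congruence_subgroup_subset by blast
    then have "\<gamma> <#\<^bsub>dual_group r\<^esub> congruence_subgroup r N \<subseteq> \<gamma> <#\<^bsub>dual_group r\<^esub> H"
      by (auto simp: l_coset_def)
    then show "(\<gamma> <#\<^bsub>dual_group r\<^esub> H) \<inter> K \<noteq> {}"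
      using meets N(1) \<gamma> by blast
  qed
qed

section \<open>Trigonometric polynomials\<close>

lemma trig_poly_eq_exponential_sum:
  "trig_poly r n x c (\<chi>, m) =
    exponential_sum {..<n} {..<r} (\<lambda>i. c i * \<chi> (fst (x i))) (\<lambda>i. snd (x i)) m"
  by (simp add: trig_poly_def char_eval_def exponential_sum_def mult.assoc)

lemma G_pts_nonzero: "x \<in> G_pts r \<Longrightarrow> snd x i \<noteq> 0"
  by (cases "i < r") (force simp: G_pts_def torus_pts_def)+

lemma trig_poly_nonzero_on_coset:
  assumes x: "\<And>i. i < n \<Longrightarrow> x i \<in> G_pts r" and nonzero: "trig_poly r n x c \<gamma> \<noteq> 0"
  shows "\<exists>N>0. \<forall>\<delta>\<in>\<gamma> <#\<^bsub>dual_group r\<^esub> congruence_subgroup r N. trig_poly r n x c \<delta> \<noteq> 0"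
proof -
  obtain \<chi> m where \<gamma>: "\<gamma> = (\<chi>, m)"
    by (cases \<gamma>)
  define p where "p = exponential_sum {..<n} {..<r} (\<lambda>i. c i * \<chi> (fst (x i))) (\<lambda>i. snd (x i))"
  have "\<exists>N>0. \<forall>k. p (\<lambda>j. m j + int N * k j) \<noteq> 0"
    using x nonzero unfolding p_def \<gamma> trig_poly_eq_exponential_sum
    by (intro exponential_sum_nonzero_on_coset) (auto dest: G_pts_nonzero)
  then obtain N where N: "N > 0" "\<And>k. p (\<lambda>j. m j + int N * k j) \<noteq> 0"
    by blast
  have "trig_poly r n x c \<delta> \<noteq> 0" if "\<delta> \<in> \<gamma> <#\<^bsub>dual_group r\<^esub> congruence_subgroup r N" for \<delta>
  proof -
    obtain \<chi>' m' where pair: "\<delta> = (\<chi>', m')"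
      by (cases \<delta>)
    then have \<delta>: "\<delta> = (\<chi>, m')" "\<forall>i. int N dvd m' i - m i"
      using that by (simp_all add: \<gamma> mem_coset_congruence_subgroup)
    then have "m' = (\<lambda>j. m j + int N * ((m' j - m j) div int N))"
      by simp
    then show ?thesis
      using N(2) unfolding \<delta>(1) trig_poly_eq_exponential_sum p_def by metis
  qed
  then show ?thesis
    using N(1) by blast
qed

lemma ubiquitous_imp_strictly_pd:
  fixes K :: "(('f::{ab_group_add, finite} \<Rightarrow> complex) \<times> (nat \<Rightarrow> int)) set"
  assumes "ubiquitous r K"
  shows "strictly_pd r K"
  unfolding strictly_pd_def
proof (intro allI impI ballI, elim conjE, rule ccontr)
  fix n x c and \<gamma> :: "('f \<Rightarrow> complex) \<times> (nat \<Rightarrow> int)"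
  assume "\<forall>i<n. x i \<in> G_pts r" "\<gamma> \<in> dual_carrier r" "trig_poly r n x c \<gamma> \<noteq> 0"
    and vanish: "\<forall>\<gamma>\<in>K. trig_poly r n x c \<gamma> = 0"
  then obtain N where "N > 0"
    "\<And>\<delta>. \<delta> \<in> \<gamma> <#\<^bsub>dual_group r\<^esub> congruence_subgroup r N \<Longrightarrow> trig_poly r n x c \<delta> \<noteq> 0"
    using trig_poly_nonzero_on_coset by metis
  moreover have "(\<gamma> <#\<^bsub>dual_group r\<^esub> congruence_subgroup r N) \<inter> K \<noteq> {}"
    using assms \<open>N > 0\<close> \<open>\<gamma> \<in> dual_carrier r\<close>
    by (simp add: ubiquitous_iff_meets_congruence_cosets)
  ultimately show False
    using vanish by blast
qed

definition torsion_pts :: "nat \<Rightarrow> nat \<Rightarrow> ('f::ab_group_add \<times> (nat \<Rightarrow> complex)) set" where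
  "torsion_pts r N = UNIV \<times> {z \<in> torus_pts r. \<forall>i. z i ^ N = 1}"

definition G_mult :: "'f::ab_group_add \<times> (nat \<Rightarrow> complex) \<Rightarrow> 'f \<times> (nat \<Rightarrow> complex) \<Rightarrow>
    'f \<times> (nat \<Rightarrow> complex)" where
  "G_mult x y = (fst x + fst y, \<lambda>i. snd x i * snd y i)"

lemma torsion_pts_subset_G_pts: "torsion_pts r N \<subseteq> G_pts r"
  by (auto simp: torsion_pts_def G_pts_def)

lemma one_in_torsion_pts: "(0, \<lambda>_. 1) \<in> torsion_pts r N"
  by (simp add: torsion_pts_def torus_pts_def)

lemma finite_torsion_pts:
  assumes "N > 0"
  shows "finite (torsion_pts r N :: ('f::{ab_group_add, finite} \<times> (nat \<Rightarrow> complex)) set)"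
proof -
  let ?Z = "{z. \<forall>i. (i \<in> {..<r} \<longrightarrow> z i \<in> {w::complex. w ^ N = 1}) \<and> (i \<notin> {..<r} \<longrightarrow> z i = 1)}"
  have "torsion_pts r N \<subseteq> (UNIV :: 'f set) \<times> ?Z"
    by (auto simp: torsion_pts_def torus_pts_def)
  moreover have "finite ?Z"
    using assms by (intro finite_set_of_finite_funs finite_roots_unity) auto
  then have "finite ((UNIV :: 'f set) \<times> ?Z)"
    by simp
  ultimately show ?thesis
    by (rule finite_subset)
qed

lemma bij_betw_G_mult_torsion_pts:
  fixes y :: "'f::{ab_group_add, finite} \<times> (nat \<Rightarrow> complex)"
  assumes "N > 0" and y: "y \<in> torsion_pts r N"
  shows "bij_betw (G_mult y) (torsion_pts r N) (torsion_pts r N)"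
proof -
  have "snd y i \<noteq> 0" for i
    using y torsion_pts_subset_G_pts G_pts_nonzero by blast
  then have "inj (G_mult y)"
    by (auto simp: inj_def G_mult_def fun_eq_iff prod_eq_iff)
  moreover have "G_mult y ` torsion_pts r N \<subseteq> torsion_pts r N"
    using y by (auto simp: torsion_pts_def torus_pts_def G_mult_def norm_mult power_mult_distrib)
  ultimately show ?thesis
    using endo_inj_surj finite_torsion_pts[OF \<open>N > 0\<close>] unfolding bij_betw_def
    by (metis inj_on_subset subset_UNIV)
qed

lemma char_eval_G_mult:
  assumes "\<gamma> \<in> dual_carrier r"
  shows "char_eval r \<gamma> (G_mult x y) = char_eval r \<gamma> x * char_eval r \<gamma> y"
  using assms
  by (auto simp: char_eval_def G_mult_def dual_carrier_def characters_add power_int_mult_distrib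
    prod.distrib)

lemma char_eval_nonzero:
  assumes "\<gamma> \<in> dual_carrier r" "x \<in> G_pts r"
  shows "char_eval r \<gamma> x \<noteq> 0"
  using assms(1) G_pts_nonzero[OF assms(2)]
  by (auto simp: char_eval_def dual_carrier_def characters_nonzero)

lemma char_eval_orthogonal:
  fixes y :: "'f::{ab_group_add, finite} \<times> (nat \<Rightarrow> complex)"
  assumes "N > 0" and \<gamma>: "\<gamma> \<in> dual_carrier r" and \<delta>: "\<delta> \<in> dual_carrier r"
    and y: "y \<in> torsion_pts r N" and neq: "char_eval r \<gamma> y \<noteq> char_eval r \<delta> y"
  shows "(\<Sum>x\<in>torsion_pts r N. inverse (char_eval r \<gamma> x) * char_eval r \<delta> x) = 0"
proof -
  let ?f = "\<lambda>x. inverse (char_eval r \<gamma> x) * char_eval r \<delta> x"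
  have "sum ?f (torsion_pts r N) = (\<Sum>x\<in>torsion_pts r N. ?f (G_mult y x))"
    using sum.reindex_bij_betw[OF bij_betw_G_mult_torsion_pts[OF assms(1) y], of ?f] by simp
  also have "\<dots> = ?f y * sum ?f (torsion_pts r N)"
    by (simp add: char_eval_G_mult \<gamma> \<delta> sum_distrib_left mult_ac)
  finally have "sum ?f (torsion_pts r N) = 0 \<or> ?f y = 1"
    by simp
  moreover have "?f y \<noteq> 1"
    using neq char_eval_nonzero[OF \<gamma>] y torsion_pts_subset_G_pts by (auto simp: field_simps)
  ultimately show ?thesis
    by blast
qed

lemma char_eval_coordinate:
  assumes "\<chi> \<in> characters" "j < r"
  shows "char_eval r (\<chi>, m) (0, (\<lambda>_. 1)(j := w)) = w powi m j"
proof -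
  have "(\<Prod>i<r. ((\<lambda>_. 1)(j := w)) i powi m i) = (\<Prod>i<r. if i = j then w powi m i else 1)"
    by (intro prod.cong) auto
  then show ?thesis
    using assms by (simp add: char_eval_def characters_zero)
qed

lemma cis_power_int_eq_1_imp_dvd:
  assumes "N > 0" "cis (2 * pi / real N) powi d = 1"
  shows "int N dvd d"
proof -
  have "cos (real_of_int d * (2 * pi / real N)) = 1"
    using assms(2) by (simp add: cis_power_int complex_eq_iff)
  then obtain k :: int where "real_of_int d * (2 * pi / real N) = real_of_int k * 2 * pi"
    by (subst (asm) cos_one_2pi_int) blast
  then have "real_of_int d = real_of_int (k * int N)"
    using assms(1) by (simp add: field_simps)
  then have "d = k * int N"
    by (simp only: of_int_eq_iff)
  then show ?thesis
    by simp
qed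

lemma eq_on_torsion_pts_imp_mem_coset:
  fixes \<gamma> :: "('f::{ab_group_add, finite} \<Rightarrow> complex) \<times> (nat \<Rightarrow> int)"
  assumes "N > 0" and \<gamma>: "\<gamma> \<in> dual_carrier r" and \<delta>: "\<delta> \<in> dual_carrier r"
    and eq: "\<And>x. x \<in> torsion_pts r N \<Longrightarrow> char_eval r \<gamma> x = char_eval r \<delta> x"
  shows "\<delta> \<in> \<gamma> <#\<^bsub>dual_group r\<^esub> congruence_subgroup r N"
proof -
  obtain \<chi> m \<chi>' m' where pairs: "\<gamma> = (\<chi>, m)" "\<delta> = (\<chi>', m')"
    by (cases \<gamma>, cases \<delta>)
  have "\<chi> f = \<chi>' f" for f
    using eq[of "(f, \<lambda>_. 1)"] by (simp add: torsion_pts_def torus_pts_def char_eval_def pairs)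
  moreover have "int N dvd m' j - m j" for j
  proof (cases "j < r")
    case True
    define \<zeta> where "\<zeta> = cis (2 * pi / real N)"
    have \<zeta>: "\<zeta> ^ N = 1" "norm \<zeta> = 1" "\<zeta> \<noteq> 0"
      using \<open>N > 0\<close> by (auto simp: \<zeta>_def DeMoivre)
    have "(0, (\<lambda>_. 1)(j := \<zeta>)) \<in> torsion_pts r N"
      using True \<zeta> by (auto simp: torsion_pts_def torus_pts_def)
    then have "\<zeta> powi m j = \<zeta> powi m' j"
      using eq[of "(0, (\<lambda>_. 1)(j := \<zeta>))"] \<gamma> \<delta> True by (simp add: pairs char_eval_coordinate)
    then have "\<zeta> powi (m' j - m j) = 1"
      using \<zeta>(3) by (simp add: power_int_diff)
    then show ?thesis
      using cis_power_int_eq_1_imp_dvd[OF \<open>N > 0\<close>] by (simp add: \<zeta>_def)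
  qed (use \<gamma> \<delta> in \<open>simp add: pairs\<close>)
  ultimately show ?thesis
    using \<gamma> \<delta> by (auto simp: pairs mem_coset_congruence_subgroup)
qed

lemma strictly_pd_sum_nonzero:
  assumes "strictly_pd r K" and S: "finite S" "S \<subseteq> G_pts r"
    and \<gamma>: "\<gamma> \<in> dual_carrier r" "(\<Sum>x\<in>S. c x * char_eval r \<gamma> x) \<noteq> 0"
  obtains \<delta> where "\<delta> \<in> K" "(\<Sum>x\<in>S. c x * char_eval r \<delta> x) \<noteq> 0"
proof -
  obtain e where e: "bij_betw e {..<card S} S"
    using ex_bij_betw_nat_finite[OF S(1)] by (auto simp: atLeast0LessThan)
  have trig_poly: "trig_poly r (card S) e (c \<circ> e) \<delta> = (\<Sum>x\<in>S. c x * char_eval r \<delta> x)" for \<delta>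
    using sum.reindex_bij_betw[OF e, of "\<lambda>x. c x * char_eval r \<delta> x"] by (simp add: trig_poly_def)
  have "\<forall>i<card S. e i \<in> G_pts r"
    using e S(2) by (auto simp: bij_betw_def)
  then have "\<exists>\<delta>\<in>K. trig_poly r (card S) e (c \<circ> e) \<delta> \<noteq> 0"
    using assms(1) \<gamma> unfolding strictly_pd_def trig_poly[symmetric] by blast
  then show ?thesis
    using that by (auto simp: trig_poly)
qed

lemma strictly_pd_imp_ubiquitous:
  fixes K :: "(('f::{ab_group_add, finite} \<Rightarrow> complex) \<times> (nat \<Rightarrow> int)) set"
  assumes K: "K \<subseteq> dual_carrier r" and spd: "strictly_pd r K"
  shows "ubiquitous r K"
  unfolding ubiquitous_iff_meets_congruence_cosets
proof (intro allI impI ballI)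
  fix N :: nat and \<gamma> :: "('f \<Rightarrow> complex) \<times> (nat \<Rightarrow> int)"
  assume "N > 0" and \<gamma>: "\<gamma> \<in> dual_carrier r"
  let ?T = "torsion_pts r N :: ('f \<times> (nat \<Rightarrow> complex)) set"
  have "char_eval r \<gamma> x \<noteq> 0" if "x \<in> ?T" for x
    using char_eval_nonzero[OF \<gamma>] that torsion_pts_subset_G_pts by blast
  then have "(\<Sum>x\<in>?T. inverse (char_eval r \<gamma> x) * char_eval r \<gamma> x) = (\<Sum>x\<in>?T. 1)"
    by (intro sum.cong) auto
  also have "\<dots> \<noteq> 0"
    using finite_torsion_pts[OF \<open>N > 0\<close>] one_in_torsion_pts by (auto simp: card_eq_0_iff)
  finally obtain \<delta> where \<delta>: "\<delta> \<in> K"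
    "(\<Sum>x\<in>?T. inverse (char_eval r \<gamma> x) * char_eval r \<delta> x) \<noteq> 0"
    by (rule strictly_pd_sum_nonzero[OF spd finite_torsion_pts[OF \<open>N > 0\<close>]
      torsion_pts_subset_G_pts \<gamma>])
  have "char_eval r \<gamma> x = char_eval r \<delta> x" if "x \<in> ?T" for x
    using char_eval_orthogonal[OF \<open>N > 0\<close> \<gamma> _ that] \<delta> K by blast
  then have "\<delta> \<in> \<gamma> <#\<^bsub>dual_group r\<^esub> congruence_subgroup r N"
    using eq_on_torsion_pts_imp_mem_coset[OF \<open>N > 0\<close> \<gamma>] \<delta>(1) K by blast
  then show "(\<gamma> <#\<^bsub>dual_group r\<^esub> congruence_subgroup r N) \<inter> K \<noteq> {}"
    using \<delta>(1) by blast
qed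

theorem theorem1p1:
  fixes r :: nat
    and K :: "(('f::{ab_group_add, finite} \<Rightarrow> complex) \<times> (nat \<Rightarrow> int)) set"
  assumes "K \<subseteq> dual_carrier r"
  shows "strictly_pd r K \<longleftrightarrow> ubiquitous r K"
  using strictly_pd_imp_ubiquitous[OF assms] ubiquitous_imp_strictly_pd by blast

end
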